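(* Let $\mathcal B=(X,P,B)$ be an unbounded connected ballean. Then the following properties are equivalent: (i) $\mathcal B$ is thin; (ii) $\mathcal B=\mathcal B_{\mathcal I}$, where $\mathcal I=\flat(X)$, i.e., $\mathcal B$ coincides with its satellite ballean; (iii) if $A\subseteq X$ is not thick, then $A$ is bounded; (iv) $\mathcal B^{\mathcal M}$ is connected; (v) the map $C\colon X\to\mathcal P(X)$, $C(x)=X\setminus\{x\}$, is an asymorphism between $\mathcal B$ and the subballean of $\exp(\mathcal B)$ with support $C(X)$; (vi) every function $f\colon X\to\{0,1\}$ is slowly oscillating.
   Context: A ballean is a triple $\mathcal B=(X,P,B)$ where $X$ (the support) and $P\neq\emptyset$ (the radii set) are sets and $B\colon X\times P\to\mathcal P(X)$ is a map such that: $x\in B(x,\alpha)$ for all $x,\alpha$; $x\in B(y,\alpha)$ iff $y\in B(x,\alpha)$; for all $\alpha,\beta\in P$ there is $\gamma\in P$ with $B(B(x,\alpha),\beta)\subseteq B(x,\gamma)$ for all $x\in X$, where $B(A,\delta)=\bigcup_{y\in A}B(y,\delta)$ for $A\subseteq X$. The subballean on $Y\subseteq X$ is $(Y,P,B_Y)$ with $B_Y(y,\alpha)=B(y,\alpha)\cap Y$. A ballean is connected if for all $x,y\in X$ there is $\alpha\in P$ with $y\in B(x,\alpha)$. A subset $A\subseteq X$ is bounded if there is $\alpha\in P$ such that $A\subseteq B(y,\alpha)$ for every $y\in A$; $\mathcal B$ is bounded if $X$ is bounded, unbounded otherwise. $\flat(X)$ is the family of all bounded subsets of $X$ (for a connected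 unbounded ballean it is a proper ideal of subsets containing all finite subsets). $\mathcal B$ is thin if for every $\alpha\in P$ there is a bounded $V\subseteq X$ such that $B(x,\alpha)=\{x\}$ for every $x\in X\setminus V$. A subset $A\subseteq X$ is thick if for every $\alpha\in P$ there is $x\in A$ with $B(x,\alpha)\subseteq A$. A map $f\colon X\to Y$ between balleans $(X,P_X,B_X)$, $(Y,P_Y,B_Y)$ is coarse if for every $\alpha\in P_X$ there is $\beta\in P_Y$ with $f(B_X(x,\alpha))\subseteq B_Y(f(x),\beta)$ for all $x\in X$; it is an asymorphism if it is bijective and both $f$ and $f^{-1}$ are coarse. Two balleans with the same support are regarded as equal (coincide) if the identity map is an asymorphism between them. For a proper ideal $\mathcal I$ of subsets of $X$ containing all finite sets, the point ideal ballean $X_{\mathcal I}=\mathcal B_{\mathcal I}=(X,\mathcal I,B_{\mathcal I})$ has radii set $\mathcal I$ and balls $B_{\mathcal I}(x,A)=\{x\}$ if $x\notin A$, $B_{\mathcal I}(x,A)=A$ if $x\in A$. The satellite ballean of a connected unbounded ballean $\mathcal B$ is $\mathcal B_{\flat(X)}$. The hyperballean is $\exp(\mathcal B)=(\mathcal P(X),P,\exp B)$, with $\exp B(A,\alpha)=\{C\in\mathcal P(X)\mid A\subseteq B(C,\alpha),\ C\subseteq B(A,\alpha)\}$. $\mathcal B^{\mathcal M}$ denotes the subballean of $\exp(\mathcal B)$ whose support is the family of all non-empty non-thick subsets of $X$. A function $f\colon X\to\{0,1\}$ is slowly oscillating if for every $\alpha\in P$ there is a bounded subset $V$ of $X$ such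 that $|f(B(x,\alpha))|=1$ for each $x\in X\setminus V$. *)

theory Defs
  imports Main "HOL-Library.FuncSet"
begin

record ('a, 'p) ball_structure =
  support :: "'a set"
  radii :: "'p set"
  ball :: "'a \<Rightarrow> 'p \<Rightarrow> 'a set"

definition ball_of_set :: "('a, 'p) ball_structure \<Rightarrow> 'a set \<Rightarrow> 'p \<Rightarrow> 'a set" where
  "ball_of_set \<B> A \<delta> = (\<Union>y\<in>A. ball \<B> y \<delta>)"

locale ballean =
  fixes \<B> :: "('a, 'p) ball_structure"
  assumes radii_nonempty: "radii \<B> \<noteq> {}"
    and ball_subset: "\<lbrakk>x \<in> support \<B>; \<alpha> \<in> radii \<B>\<rbrakk> \<Longrightarrow> ball \<B> x \<alpha> \<subseteq> support \<B>"
    and ball_refl: "\<lbrakk>x \<in> support \<B>; \<alpha> \<in> radii \<B>\<rbrakk> \<Longrightarrow> x \<in> ball \<B> x \<alpha>"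
    and ball_sym: "\<lbrakk>x \<in> support \<B>; y \<in> support \<B>; \<alpha> \<in> radii \<B>\<rbrakk>
      \<Longrightarrow> x \<in> ball \<B> y \<alpha> \<longleftrightarrow> y \<in> ball \<B> x \<alpha>"
    and ball_comp: "\<lbrakk>\<alpha> \<in> radii \<B>; \<beta> \<in> radii \<B>\<rbrakk>
      \<Longrightarrow> \<exists>\<gamma>\<in>radii \<B>. \<forall>x\<in>support \<B>. ball_of_set \<B> (ball \<B> x \<alpha>) \<beta> \<subseteq> ball \<B> x \<gamma>"

definition subballean :: "('a, 'p) ball_structure \<Rightarrow> 'a set \<Rightarrow> ('a, 'p) ball_structure" where
  "subballean \<B> Y = \<lparr>support = Y, radii = radii \<B>, ball = (\<lambda>y \<alpha>. ball \<B> y \<alpha> \<inter> Y)\<rparr>"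

definition connected_ballean :: "('a, 'p) ball_structure \<Rightarrow> bool" where
  "connected_ballean \<B> \<longleftrightarrow>
     (\<forall>x\<in>support \<B>. \<forall>y\<in>support \<B>. \<exists>\<alpha>\<in>radii \<B>. y \<in> ball \<B> x \<alpha>)"

definition bounded_in :: "('a, 'p) ball_structure \<Rightarrow> 'a set \<Rightarrow> bool" where
  "bounded_in \<B> A \<longleftrightarrow>
     A \<subseteq> support \<B> \<and> (\<exists>\<alpha>\<in>radii \<B>. \<forall>y\<in>A. A \<subseteq> ball \<B> y \<alpha>)"

definition bounded_ballean :: "('a, 'p) ball_structure \<Rightarrow> bool" where
  "bounded_ballean \<B> \<longleftrightarrow> bounded_in \<B> (support \<B>)"

definition bounded_sets :: "('a, 'p) ball_structure \<Rightarrow> 'a set set" where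
  "bounded_sets \<B> = {A. bounded_in \<B> A}"

definition thin :: "('a, 'p) ball_structure \<Rightarrow> bool" where
  "thin \<B> \<longleftrightarrow>
     (\<forall>\<alpha>\<in>radii \<B>. \<exists>V. bounded_in \<B> V \<and> (\<forall>x\<in>support \<B> - V. ball \<B> x \<alpha> = {x}))"

definition thick_in :: "('a, 'p) ball_structure \<Rightarrow> 'a set \<Rightarrow> bool" where
  "thick_in \<B> A \<longleftrightarrow>
     A \<subseteq> support \<B> \<and> (\<forall>\<alpha>\<in>radii \<B>. \<exists>x\<in>A. ball \<B> x \<alpha> \<subseteq> A)"

definition coarse_map ::
  "('a, 'p) ball_structure \<Rightarrow> ('b, 'q) ball_structure \<Rightarrow> ('a \<Rightarrow> 'b) \<Rightarrow> bool" where
  "coarse_map \<B> \<C> f \<longleftrightarrow>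
     f \<in> support \<B> \<rightarrow> support \<C> \<and>
     (\<forall>\<alpha>\<in>radii \<B>. \<exists>\<beta>\<in>radii \<C>. \<forall>x\<in>support \<B>. f ` ball \<B> x \<alpha> \<subseteq> ball \<C> (f x) \<beta>)"

definition asymorphism ::
  "('a, 'p) ball_structure \<Rightarrow> ('b, 'q) ball_structure \<Rightarrow> ('a \<Rightarrow> 'b) \<Rightarrow> bool" where
  "asymorphism \<B> \<C> f \<longleftrightarrow>
     bij_betw f (support \<B>) (support \<C>) \<and>
     coarse_map \<B> \<C> f \<and> coarse_map \<C> \<B> (inv_into (support \<B>) f)"

text \<open>Equality of balleans on the same support, which ignores how the radii are named;
  in particular the two radii sets may have different types.\<close>

definition coincide :: "('a, 'p) ball_structure \<Rightarrow> ('a, 'q) ball_structure \<Rightarrow> bool" where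
  "coincide \<B> \<C> \<longleftrightarrow> support \<B> = support \<C> \<and> asymorphism \<B> \<C> (\<lambda>x. x)"

definition point_ideal_ballean :: "'a set \<Rightarrow> 'a set set \<Rightarrow> ('a, 'a set) ball_structure" where
  "point_ideal_ballean X \<I> =
     \<lparr>support = X, radii = \<I>, ball = (\<lambda>x A. if x \<in> A then A else {x})\<rparr>"

definition satellite :: "('a, 'p) ball_structure \<Rightarrow> ('a, 'a set) ball_structure" where
  "satellite \<B> = point_ideal_ballean (support \<B>) (bounded_sets \<B>)"

definition exp_ballean :: "('a, 'p) ball_structure \<Rightarrow> ('a set, 'p) ball_structure" where
  "exp_ballean \<B> =
     \<lparr>support = Pow (support \<B>), radii = radii \<B>,
      ball = (\<lambda>A \<alpha>. {C \<in> Pow (support \<B>).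
        A \<subseteq> ball_of_set \<B> C \<alpha> \<and> C \<subseteq> ball_of_set \<B> A \<alpha>})\<rparr>"

definition nonthick_hyperballean :: "('a, 'p) ball_structure \<Rightarrow> ('a set, 'p) ball_structure" where
  "nonthick_hyperballean \<B> =
     subballean (exp_ballean \<B>) {A. A \<subseteq> support \<B> \<and> A \<noteq> {} \<and> \<not> thick_in \<B> A}"

definition slowly_oscillating :: "('a, 'p) ball_structure \<Rightarrow> ('a \<Rightarrow> nat) \<Rightarrow> bool" where
  "slowly_oscillating \<B> f \<longleftrightarrow>
     (\<forall>\<alpha>\<in>radii \<B>. \<exists>V. bounded_in \<B> V \<and>
        (\<forall>x\<in>support \<B> - V. card (f ` ball \<B> x \<alpha>) = 1))"

text \<open>The constructions above do yield balleans.\<close>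

lemma (in ballean) ballean_subballean: "Y \<subseteq> support \<B> \<Longrightarrow> ballean (subballean \<B> Y)"
proof
  fix \<alpha> \<beta> assume Y: "Y \<subseteq> support \<B>"
    and ab: "\<alpha> \<in> radii (subballean \<B> Y)" "\<beta> \<in> radii (subballean \<B> Y)"
  then obtain \<gamma> where "\<gamma> \<in> radii \<B>"
    "\<forall>x\<in>support \<B>. ball_of_set \<B> (ball \<B> x \<alpha>) \<beta> \<subseteq> ball \<B> x \<gamma>"
    using ball_comp[of \<alpha> \<beta>] by (auto simp: subballean_def)
  then show "\<exists>\<gamma>\<in>radii (subballean \<B> Y). \<forall>x\<in>support (subballean \<B> Y).
      ball_of_set (subballean \<B> Y) (ball (subballean \<B> Y) x \<alpha>) \<beta>
        \<subseteq> ball (subballean \<B> Y) x \<gamma>"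
    using Y by (intro bexI[of _ \<gamma>]) (fastforce simp: subballean_def ball_of_set_def)+
qed (use radii_nonempty ball_refl ball_sym in \<open>auto simp: subballean_def subset_iff\<close>)

lemma (in ballean) ballean_exp: "ballean (exp_ballean \<B>)"
proof
  fix \<alpha> \<beta> assume ab: "\<alpha> \<in> radii (exp_ballean \<B>)" "\<beta> \<in> radii (exp_ballean \<B>)"
  then have ab': "\<alpha> \<in> radii \<B>" "\<beta> \<in> radii \<B>" by (auto simp: exp_ballean_def)
  obtain \<gamma> where g: "\<gamma> \<in> radii \<B>"
    "\<And>x. x \<in> support \<B> \<Longrightarrow> ball_of_set \<B> (ball \<B> x \<alpha>) \<beta> \<subseteq> ball \<B> x \<gamma>"
    using ball_comp[OF ab'] by blast
  have comp: "z \<in> ball \<B> x \<gamma>"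
    if "x \<in> support \<B>" "y \<in> ball \<B> x \<alpha>" "z \<in> ball \<B> y \<beta>" for x y z
    using g(2)[of x] that by (auto simp: ball_of_set_def)
  have comp': "x \<in> ball \<B> z \<gamma>"
    if "z \<in> support \<B>" "x \<in> ball \<B> y \<alpha>" "y \<in> ball \<B> z \<beta>" for x y z
  proof -
    have y: "y \<in> support \<B>" using that ball_subset ab' by blast
    have x: "x \<in> support \<B>" using y that ball_subset ab' by blast
    have "z \<in> ball \<B> x \<gamma>" using comp[OF x] that x y ball_sym ab' by blast
    then show ?thesis using ball_sym x that(1) g(1) by blast
  qed
  show "\<exists>\<gamma>\<in>radii (exp_ballean \<B>). \<forall>x\<in>support (exp_ballean \<B>).
      ball_of_set (exp_ballean \<B>) (ball (exp_ballean \<B>) x \<alpha>) \<beta>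
        \<subseteq> ball (exp_ballean \<B>) x \<gamma>"
  proof (intro bexI ballI subsetI)
    fix A D
    assume "A \<in> support (exp_ballean \<B>)"
      and "D \<in> ball_of_set (exp_ballean \<B>) (ball (exp_ballean \<B>) A \<alpha>) \<beta>"
    then obtain C where "A \<in> Pow (support \<B>)" "C \<in> ball (exp_ballean \<B>) A \<alpha>"
      "D \<in> ball (exp_ballean \<B>) C \<beta>"
      by (auto simp: exp_ballean_def ball_of_set_def)
    then have *: "A \<subseteq> support \<B>" "C \<subseteq> support \<B>" "D \<subseteq> support \<B>"
      "A \<subseteq> ball_of_set \<B> C \<alpha>" "C \<subseteq> ball_of_set \<B> A \<alpha>"
      "C \<subseteq> ball_of_set \<B> D \<beta>" "D \<subseteq> ball_of_set \<B> C \<beta>"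
      by (simp_all add: exp_ballean_def)
    have "D \<subseteq> ball_of_set \<B> A \<gamma>"
    proof
      fix z assume "z \<in> D"
      then obtain y where y: "y \<in> C" "z \<in> ball \<B> y \<beta>" using * by (auto simp: ball_of_set_def)
      then obtain x where "x \<in> A" "y \<in> ball \<B> x \<alpha>" using * by (auto simp: ball_of_set_def)
      then show "z \<in> ball_of_set \<B> A \<gamma>"
        using comp y(2) *(1) unfolding ball_of_set_def by blast
    qed
    moreover have "A \<subseteq> ball_of_set \<B> D \<gamma>"
    proof
      fix x assume "x \<in> A"
      then obtain y where y: "y \<in> C" "x \<in> ball \<B> y \<alpha>" using * by (auto simp: ball_of_set_def)
      then obtain z where "z \<in> D" "y \<in> ball \<B> z \<beta>" using * by (auto simp: ball_of_set_def)
      then show "x \<in> ball_of_set \<B> D \<gamma>"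
        using comp' y(2) *(3) unfolding ball_of_set_def by blast
    qed
    ultimately show "D \<in> ball (exp_ballean \<B>) A \<gamma>"
      using * by (simp add: exp_ballean_def)
  qed (use g in \<open>simp add: exp_ballean_def\<close>)
qed (use radii_nonempty ball_refl in \<open>auto simp: exp_ballean_def ball_of_set_def subset_iff\<close>)

lemma ballean_point_ideal:
  assumes "\<I> \<noteq> {}" "\<And>A. A \<in> \<I> \<Longrightarrow> A \<subseteq> X" "\<And>A B. \<lbrakk>A \<in> \<I>; B \<in> \<I>\<rbrakk> \<Longrightarrow> A \<union> B \<in> \<I>"
  shows "ballean (point_ideal_ballean X \<I>)"
proof
  fix \<alpha> \<beta> assume "\<alpha> \<in> radii (point_ideal_ballean X \<I>)" "\<beta> \<in> radii (point_ideal_ballean X \<I>)"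
  then show "\<exists>\<gamma>\<in>radii (point_ideal_ballean X \<I>). \<forall>x\<in>support (point_ideal_ballean X \<I>).
      ball_of_set (point_ideal_ballean X \<I>) (ball (point_ideal_ballean X \<I>) x \<alpha>) \<beta>
        \<subseteq> ball (point_ideal_ballean X \<I>) x \<gamma>"
    by (intro bexI[of _ "\<alpha> \<union> \<beta>"])
      (use assms in \<open>auto simp: point_ideal_ballean_def ball_of_set_def split: if_splits\<close>)
qed (use assms in \<open>auto simp: point_ideal_ballean_def split: if_splits\<close>)

end

theory Submission
  imports Defs
begin

text \<open>Everything is expressed through the sets of points moved by a radius \<open>\<alpha>\<close>, i.e. those with
  \<open>B(x,\<alpha>) \<noteq> {x}\<close>: thinness says that all of them are bounded. This is immediately (ii); a non-thick
  set consists of moved points for some radius; and two distinct complements of points are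
  \<open>\<alpha>\<close>-close in the hyperballean iff both points are moved by \<open>\<alpha>\<close>, whence (v).
  Conversely, if the set of points moved by \<open>\<alpha>\<close> is unbounded, then so is a maximal
  \<open>\<alpha>\<close>-discrete subset \<open>S\<close> of it, by maximality; no ball of radius \<open>\<alpha>\<close> around a point of \<open>S\<close>
  lies in \<open>S\<close>, so \<open>S\<close> refutes (iii) and its indicator function refutes (vi). Finally, singletons are
  non-thick and the sets connected to a singleton are the non-empty bounded ones, whence (iv).\<close>

section \<open>Moved points and discrete sets\<close>

definition moved :: "('a, 'p) ball_structure \<Rightarrow> 'p \<Rightarrow> 'a set" where
  "moved \<B> \<alpha> = {x \<in> support \<B>. ball \<B> x \<alpha> \<noteq> {x}}"

text \<open>Zorn's lemma for inclusion. Since \<open>R\<close> is arbitrary, a point outside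
  \<open>S\<close> may conflict with \<open>S\<close> in either direction, hence the
  disjunction.\<close>

lemma exists_maximal_discrete_subset:
  obtains S where "S \<subseteq> N" "\<forall>x\<in>S. \<forall>y\<in>S. x \<noteq> y \<longrightarrow> \<not> R x y"
    "\<forall>z\<in>N - S. \<exists>x\<in>S. R x z \<or> R z x"
proof -
  let ?F = "{S. S \<subseteq> N \<and> (\<forall>x\<in>S. \<forall>y\<in>S. x \<noteq> y \<longrightarrow> \<not> R x y)}"
  have "\<Union>\<C> \<in> ?F" if "subset.chain ?F \<C>" for \<C>
  proof -
    have F: "\<C> \<subseteq> ?F"
      using \<open>subset.chain ?F \<C>\<close> by (simp add: subset_chain_def)
    have lin: "S \<subseteq> T \<or> T \<subseteq> S" if "S \<in> \<C>" "T \<in> \<C>" for S T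
      using that \<open>subset.chain ?F \<C>\<close> by (auto simp: subset_chain_def)
    show ?thesis
    proof (intro CollectI conjI ballI impI)
      show "\<Union>\<C> \<subseteq> N" using F by blast
      fix x y assume "x \<in> \<Union>\<C>" "y \<in> \<Union>\<C>" "x \<noteq> y"
      then obtain S T where ST: "S \<in> \<C>" "T \<in> \<C>" "x \<in> S" "y \<in> T" by blast
      \<comment> \<open>Of two members of the chain the larger contains both points.\<close>
      with lin have "\<exists>U\<in>\<C>. x \<in> U \<and> y \<in> U" by (meson subsetD)
      with F \<open>x \<noteq> y\<close> show "\<not> R x y" by blast
    qed
  qed
  from subset_Zorn'[of ?F, OF this]
  obtain S where S: "S \<in> ?F" and max: "\<forall>T\<in>?F. S \<subseteq> T \<longrightarrow> T = S" ..
  have "\<exists>x\<in>S. R x z \<or> R z x" if "z \<in> N - S" for z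
  proof (rule ccontr)
    assume "\<not> ?thesis"
    \<comment> \<open>As \<open>z\<close> is unrelated to all of \<open>S\<close> in both
      directions, adding it keeps the set discrete.\<close>
    with S that have "insert z S \<in> ?F" by blast
    from bspec[OF max this] have "insert z S = S" by (simp add: subset_insertI)
    with that show False by blast
  qed
  with S show ?thesis by (intro that[of S]) auto
qed

context ballean
begin

section \<open>Bounded sets\<close>

lemma bounded_in_subset: "bounded_in \<B> A \<Longrightarrow> C \<subseteq> A \<Longrightarrow> bounded_in \<B> C"
  unfolding bounded_in_def by blast

text \<open>Boundedness asks for one radius that works around every point of the set. Symmetry leads
  from any such point back to the centre \<open>x\<close>, and composing \<alpha> with itself gives
  the radius.\<close>

lemma bounded_in_ball:
  assumes "x \<in> support \<B>" "\<alpha> \<in> radii \<B>"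
  shows "bounded_in \<B> (ball \<B> x \<alpha>)"
proof -
  obtain \<gamma> where g: "\<gamma> \<in> radii \<B>"
    "\<And>x. x \<in> support \<B> \<Longrightarrow> ball_of_set \<B> (ball \<B> x \<alpha>) \<alpha> \<subseteq> ball \<B> x \<gamma>"
    using ball_comp[OF assms(2) assms(2)] by blast
  have "ball \<B> x \<alpha> \<subseteq> ball \<B> y \<gamma>" if y: "y \<in> ball \<B> x \<alpha>" for y
  proof -
    have "y \<in> support \<B>" using y ball_subset assms by blast
    moreover from this have "x \<in> ball \<B> y \<alpha>" using y ball_sym assms by blast
    ultimately show ?thesis using g(2)[of y] by (auto simp: ball_of_set_def)
  qed
  with g(1) show ?thesis
    using ball_subset[OF assms] unfolding bounded_in_def by blast
qed

text \<open>Reduces boundedness to a single centre. The non-empty support provides a centre when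
  \<open>A\<close> is empty.\<close>

lemma bounded_in_iff_subset_ball:
  assumes "support \<B> \<noteq> {}"
  shows "bounded_in \<B> A \<longleftrightarrow> (\<exists>x\<in>support \<B>. \<exists>\<alpha>\<in>radii \<B>. A \<subseteq> ball \<B> x \<alpha>)"
proof
  assume A: "bounded_in \<B> A"
  show "\<exists>x\<in>support \<B>. \<exists>\<alpha>\<in>radii \<B>. A \<subseteq> ball \<B> x \<alpha>"
  proof (cases "A = {}")
    case True
    then show ?thesis using assms radii_nonempty by blast
  next
    case False
    then show ?thesis using A unfolding bounded_in_def by blast
  qed
next
  assume "\<exists>x\<in>support \<B>. \<exists>\<alpha>\<in>radii \<B>. A \<subseteq> ball \<B> x \<alpha>"
  then show "bounded_in \<B> A" using bounded_in_ball bounded_in_subset by blast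
qed

lemma bounded_in_ball_of_set:
  assumes A: "bounded_in \<B> A" and \<beta>: "\<beta> \<in> radii \<B>"
  shows "bounded_in \<B> (ball_of_set \<B> A \<beta>)"
proof (cases "A = {}")
  case True
  then show ?thesis using A by (simp add: ball_of_set_def)
next
  case False
  then have ne: "support \<B> \<noteq> {}" using A unfolding bounded_in_def by blast
  obtain x \<alpha> where x: "x \<in> support \<B>" "\<alpha> \<in> radii \<B>" "A \<subseteq> ball \<B> x \<alpha>"
    using A bounded_in_iff_subset_ball[OF ne] by blast
  then have "ball_of_set \<B> A \<beta> \<subseteq> ball_of_set \<B> (ball \<B> x \<alpha>) \<beta>"
    by (auto simp: ball_of_set_def)
  with ball_comp[OF x(2) \<beta>] x(1) show ?thesis
    using bounded_in_iff_subset_ball[OF ne] by (meson subset_trans)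
qed

text \<open>Connectedness yields a radius \<delta> joining a point of \<open>A\<close> to a point of
  \<open>C\<close>; enlarging along this link keeps the set bounded.\<close>

lemma bounded_in_Un:
  assumes conn: "connected_ballean \<B>" and A: "bounded_in \<B> A" and C: "bounded_in \<B> C"
  shows "bounded_in \<B> (A \<union> C)"
proof (cases "A = {} \<or> C = {}")
  case True
  then show ?thesis using A C by auto
next
  case False
  then obtain a c where ac: "a \<in> A" "c \<in> C" by blast
  then have X: "a \<in> support \<B>" "c \<in> support \<B>" using A C unfolding bounded_in_def by auto
  obtain \<alpha> where \<alpha>: "\<alpha> \<in> radii \<B>" "A \<subseteq> ball \<B> a \<alpha>"
    using A ac unfolding bounded_in_def by blast
  obtain \<gamma> where \<gamma>: "\<gamma> \<in> radii \<B>" "C \<subseteq> ball \<B> c \<gamma>"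
    using C ac unfolding bounded_in_def by blast
  obtain \<delta> where \<delta>: "\<delta> \<in> radii \<B>" "c \<in> ball \<B> a \<delta>"
    using conn X unfolding connected_ballean_def by blast
  obtain \<beta> where \<beta>: "\<beta> \<in> radii \<B>"
    "ball_of_set \<B> (ball \<B> a \<alpha>) \<delta> \<subseteq> ball \<B> a \<beta>"
    using ball_comp[OF \<alpha>(1) \<delta>(1)] X by blast
  \<comment> \<open>It suffices to attach the single point \<open>c\<close>: since \<open>C\<close>
    lies in the \<gamma>-ball around \<open>c\<close>, one more enlargement by \<gamma> absorbs
    \<open>C\<close>.\<close>
  have "A \<union> {c} \<subseteq> ball \<B> a \<beta>"
  proof -
    have "A \<subseteq> ball_of_set \<B> (ball \<B> a \<alpha>) \<delta>"
    proof
      fix y assume "y \<in> A"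
      then show "y \<in> ball_of_set \<B> (ball \<B> a \<alpha>) \<delta>"
        using A \<alpha> \<delta> ball_refl unfolding ball_of_set_def bounded_in_def by blast
    qed
    moreover have "c \<in> ball_of_set \<B> (ball \<B> a \<alpha>) \<delta>"
      using X \<alpha> \<delta> ball_refl unfolding ball_of_set_def by blast
    ultimately show ?thesis using \<beta>(2) by blast
  qed
  then have "bounded_in \<B> (A \<union> {c})"
    using bounded_in_ball[OF X(1) \<beta>(1)] bounded_in_subset by blast
  then have "bounded_in \<B> (ball_of_set \<B> (A \<union> {c}) \<gamma>)"
    using bounded_in_ball_of_set \<gamma>(1) by blast
  moreover have "A \<union> C \<subseteq> ball_of_set \<B> (A \<union> {c}) \<gamma>"
  proof
    fix y assume "y \<in> A \<union> C"
    then show "y \<in> ball_of_set \<B> (A \<union> {c}) \<gamma>"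
      using A \<gamma> ball_refl unfolding ball_of_set_def bounded_in_def by blast
  qed
  ultimately show ?thesis by (rule bounded_in_subset)
qed

section \<open>Thinness in terms of moved points\<close>

lemma moved_memI:
  "\<alpha> \<in> radii \<B> \<Longrightarrow> x \<in> support \<B> \<Longrightarrow> y \<in> ball \<B> x \<alpha> \<Longrightarrow> x \<noteq> y \<Longrightarrow> x \<in> moved \<B> \<alpha>"
  unfolding moved_def by auto

lemma moved_memE:
  assumes "\<alpha> \<in> radii \<B>" "x \<in> moved \<B> \<alpha>"
  obtains y where "x \<in> support \<B>" "y \<in> support \<B>" "y \<in> ball \<B> x \<alpha>" "x \<in> ball \<B> y \<alpha>" "y \<noteq> x"
proof -
  have x: "x \<in> support \<B>" "ball \<B> x \<alpha> \<noteq> {x}" using assms(2) by (auto simp: moved_def)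
  then obtain y where y: "y \<in> ball \<B> x \<alpha>" "y \<noteq> x" using ball_refl assms(1) by blast
  then have "y \<in> support \<B>" using ball_subset x assms(1) by blast
  with x y that show ?thesis using ball_sym assms(1) by blast
qed

text \<open>For each \<alpha> one candidate decides: \<open>moved \<B> \<alpha>\<close> is contained
  in every \<open>V\<close> that thinness allows, and it can serve as \<open>V\<close> as soon as it
  is bounded.\<close>

lemma thin_iff_moved_bounded: "thin \<B> \<longleftrightarrow> (\<forall>\<alpha>\<in>radii \<B>. bounded_in \<B> (moved \<B> \<alpha>))"
proof
  assume thin: "thin \<B>"
  show "\<forall>\<alpha>\<in>radii \<B>. bounded_in \<B> (moved \<B> \<alpha>)"
  proof
    fix \<alpha> assume "\<alpha> \<in> radii \<B>"
    with thin obtain V where V: "bounded_in \<B> V" "\<forall>x\<in>support \<B> - V. ball \<B> x \<alpha> = {x}"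
      unfolding thin_def by blast
    then have "moved \<B> \<alpha> \<subseteq> V" unfolding moved_def by blast
    with V(1) show "bounded_in \<B> (moved \<B> \<alpha>)" by (rule bounded_in_subset)
  qed
next
  assume "\<forall>\<alpha>\<in>radii \<B>. bounded_in \<B> (moved \<B> \<alpha>)"
  moreover have "\<forall>x\<in>support \<B> - moved \<B> \<alpha>. ball \<B> x \<alpha> = {x}" for \<alpha>
    unfolding moved_def by blast
  ultimately show "thin \<B>" unfolding thin_def by blast
qed

text \<open>Supplies the counterexample set for both non-thick sets and slow oscillation.\<close>

lemma moved_unboundedE:
  assumes \<alpha>: "\<alpha> \<in> radii \<B>" and unb: "\<not> bounded_in \<B> (moved \<B> \<alpha>)"
  obtains S where "S \<subseteq> support \<B>" "\<not> bounded_in \<B> S" "\<forall>x\<in>S. \<exists>y\<in>ball \<B> x \<alpha>. y \<notin> S"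
proof -
  obtain S where S: "S \<subseteq> moved \<B> \<alpha>"
    and disc: "\<forall>x\<in>S. \<forall>y\<in>S. x \<noteq> y \<longrightarrow> \<not> y \<in> ball \<B> x \<alpha>"
    and max: "\<forall>z\<in>moved \<B> \<alpha> - S. \<exists>x\<in>S. z \<in> ball \<B> x \<alpha> \<or> x \<in> ball \<B> z \<alpha>"
    by (rule exists_maximal_discrete_subset[of "moved \<B> \<alpha>" "\<lambda>x y. y \<in> ball \<B> x \<alpha>"])
  have sup: "moved \<B> \<alpha> \<subseteq> support \<B>" by (auto simp: moved_def)
  have "moved \<B> \<alpha> \<subseteq> ball_of_set \<B> S \<alpha>"
  proof
    fix z assume z: "z \<in> moved \<B> \<alpha>"
    show "z \<in> ball_of_set \<B> S \<alpha>"
    proof (cases "z \<in> S")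
      case True
      with z sup ball_refl \<alpha> show ?thesis unfolding ball_of_set_def by blast
    next
      case False
      with max z obtain x where "x \<in> S" "z \<in> ball \<B> x \<alpha> \<or> x \<in> ball \<B> z \<alpha>" by blast
      moreover from this have "x \<in> support \<B>" "z \<in> support \<B>" using S sup z by auto
      ultimately show ?thesis using ball_sym \<alpha> unfolding ball_of_set_def by blast
    qed
  qed
  with unb have "\<not> bounded_in \<B> S"
    using bounded_in_ball_of_set \<alpha> bounded_in_subset by blast
  \<comment> \<open>A moved point \<open>x\<close> has a second point in its \<alpha>-ball, and
    discreteness keeps that point out of \<open>S\<close>.\<close>
  moreover have "\<forall>x\<in>S. \<exists>y\<in>ball \<B> x \<alpha>. y \<notin> S"
    using moved_memE[OF \<alpha>] S disc by (metis subsetD)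
  ultimately show ?thesis using S sup that by blast
qed

section \<open>The satellite ballean\<close>

text \<open>For thin \<B> the radius of the satellite matching \<alpha> is
  \<open>moved \<B> \<alpha>\<close>. Conversely, a radius \<open>A\<close> of the satellite that
  dominates \<alpha> is a bounded set outside which \<alpha>-balls are trivial.\<close>

lemma thin_iff_coincide_satellite: "thin \<B> \<longleftrightarrow> coincide \<B> (satellite \<B>)"
proof
  assume "thin \<B>"
  then have bdd: "moved \<B> \<alpha> \<in> bounded_sets \<B>" if "\<alpha> \<in> radii \<B>" for \<alpha>
    using that by (simp add: thin_iff_moved_bounded bounded_sets_def)
  have ball_moved: "ball \<B> x \<alpha> \<subseteq> (if x \<in> moved \<B> \<alpha> then moved \<B> \<alpha> else {x})"
    if "\<alpha> \<in> radii \<B>" "x \<in> support \<B>" for x \<alpha>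
  proof (cases "x \<in> moved \<B> \<alpha>")
    case True
    \<comment> \<open>By symmetry a point \<open>y\<close> other than \<open>x\<close> has
      \<open>x\<close> in its own ball, so it is moved too.\<close>
    have "y \<in> moved \<B> \<alpha>" if y: "y \<in> ball \<B> x \<alpha>" for y
    proof (cases "y = x")
      case True
      with \<open>x \<in> moved \<B> \<alpha>\<close> show ?thesis by simp
    next
      case False
      moreover have "y \<in> support \<B>"
        using ball_subset[OF \<open>x \<in> support \<B>\<close> \<open>\<alpha> \<in> radii \<B>\<close>] y by blast
      ultimately show ?thesis
        using moved_memI ball_sym \<open>x \<in> support \<B>\<close> \<open>\<alpha> \<in> radii \<B>\<close> y by blast
    qed
    with True show ?thesis by auto
  next
    case False
    then show ?thesis using that by (auto simp: moved_def)
  qed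
  have "\<exists>A\<in>bounded_sets \<B>. \<forall>x\<in>support \<B>. ball \<B> x \<alpha> \<subseteq> (if x \<in> A then A else {x})"
    if "\<alpha> \<in> radii \<B>" for \<alpha>
    by (rule bexI[OF _ bdd[OF that]], rule ballI, rule ball_moved[OF that])
  then have "coarse_map \<B> (satellite \<B>) (\<lambda>x. x)"
    unfolding coarse_map_def by (simp add: satellite_def point_ideal_ballean_def)
  moreover have "coarse_map (satellite \<B>) \<B> (inv_into (support \<B>) (\<lambda>x. x))"
  proof -
    \<comment> \<open>\<open>inv_into\<close> is only determined on the image, here the support, so
      it cannot simply be replaced by the identity.\<close>
    have inv: "inv_into (support \<B>) (\<lambda>x. x) x = x" if "x \<in> support \<B>" for x
      using inv_into_f_f[of "\<lambda>x. x" "support \<B>" x] that by (simp add: inj_on_def)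
    have "\<exists>\<beta>\<in>radii \<B>. \<forall>x\<in>support \<B>.
        inv_into (support \<B>) (\<lambda>x. x) ` (if x \<in> A then A else {x}) \<subseteq>
        ball \<B> (inv_into (support \<B>) (\<lambda>x. x) x) \<beta>" if A: "A \<in> bounded_sets \<B>" for A
    proof -
      \<comment> \<open>The radius \<beta> witnessing that \<open>A\<close> is bounded is also the
        one needed: satellite balls of radius \<open>A\<close> are \<open>A\<close> itself around
        points of \<open>A\<close>, and singletons elsewhere.\<close>
      obtain \<beta> where \<beta>: "\<beta> \<in> radii \<B>" "A \<subseteq> support \<B>" "\<forall>y\<in>A. A \<subseteq> ball \<B> y \<beta>"
        using A unfolding bounded_sets_def bounded_in_def by blast
      have "inv_into (support \<B>) (\<lambda>x. x) ` A = A" using \<beta>(2) inv by force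
      with \<beta> show ?thesis by (intro bexI[of _ \<beta>]) (auto simp: inv ball_refl)
    qed
    then show ?thesis
      unfolding coarse_map_def satellite_def point_ideal_ballean_def by (auto simp: inv)
  qed
  ultimately show "coincide \<B> (satellite \<B>)"
    unfolding coincide_def asymorphism_def
    by (simp add: satellite_def point_ideal_ballean_def bij_betw_def)
next
  assume "coincide \<B> (satellite \<B>)"
  then have "coarse_map \<B> (satellite \<B>) (\<lambda>x. x)"
    unfolding coincide_def asymorphism_def by blast
  then have *: "\<exists>A. bounded_in \<B> A \<and>
      (\<forall>x\<in>support \<B>. ball \<B> x \<alpha> \<subseteq> (if x \<in> A then A else {x}))" if "\<alpha> \<in> radii \<B>" for \<alpha>
    using that unfolding coarse_map_def satellite_def point_ideal_ballean_def bounded_sets_def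
    by simp
  show "thin \<B>"
    unfolding thin_def
  proof
    fix \<alpha> assume \<alpha>: "\<alpha> \<in> radii \<B>"
    then obtain A where A: "bounded_in \<B> A"
      "\<forall>x\<in>support \<B>. ball \<B> x \<alpha> \<subseteq> (if x \<in> A then A else {x})"
      using * by blast
    then have "\<forall>x\<in>support \<B> - A. ball \<B> x \<alpha> = {x}" using ball_refl \<alpha> by fastforce
    with A(1) show "\<exists>V. bounded_in \<B> V \<and> (\<forall>x\<in>support \<B> - V. ball \<B> x \<alpha> = {x})" by blast
  qed
qed

section \<open>Non-thick sets and slow oscillation\<close>

lemma thin_iff_nonthick_bounded:
  "thin \<B> \<longleftrightarrow> (\<forall>A. A \<subseteq> support \<B> \<and> \<not> thick_in \<B> A \<longrightarrow> bounded_in \<B> A)"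
proof (intro iffI allI impI)
  fix A assume thin: "thin \<B>" and A: "A \<subseteq> support \<B> \<and> \<not> thick_in \<B> A"
  then obtain \<alpha> where \<alpha>: "\<alpha> \<in> radii \<B>" "\<forall>x\<in>A. \<not> ball \<B> x \<alpha> \<subseteq> A"
    unfolding thick_in_def by blast
  \<comment> \<open>A ball around \<open>x\<close> in \<open>A\<close> that leaves \<open>A\<close>
    is not \<open>{x}\<close>.\<close>
  then have "A \<subseteq> moved \<B> \<alpha>" using A by (auto simp: moved_def)
  then show "bounded_in \<B> A" using thin \<alpha>(1) thin_iff_moved_bounded bounded_in_subset by blast
next
  assume R: "\<forall>A. A \<subseteq> support \<B> \<and> \<not> thick_in \<B> A \<longrightarrow> bounded_in \<B> A"
  show "thin \<B>"
  proof (rule ccontr)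
    assume "\<not> thin \<B>"
    then obtain \<alpha> where \<alpha>: "\<alpha> \<in> radii \<B>" "\<not> bounded_in \<B> (moved \<B> \<alpha>)"
      using thin_iff_moved_bounded by blast
    then obtain S where S: "S \<subseteq> support \<B>" "\<not> bounded_in \<B> S"
      "\<forall>x\<in>S. \<exists>y\<in>ball \<B> x \<alpha>. y \<notin> S"
      by (rule moved_unboundedE)
    then have "\<not> thick_in \<B> S" using \<alpha>(1) unfolding thick_in_def by blast
    with R S show False by blast
  qed
qed

lemma thin_iff_slowly_oscillating:
  "thin \<B> \<longleftrightarrow> (\<forall>f\<in>support \<B> \<rightarrow> {0, 1}. slowly_oscillating \<B> f)"
proof
  assume thin: "thin \<B>"
  have "slowly_oscillating \<B> f" for f
    unfolding slowly_oscillating_def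
  proof
    fix \<alpha> assume "\<alpha> \<in> radii \<B>"
    with thin obtain V where "bounded_in \<B> V" "\<forall>x\<in>support \<B> - V. ball \<B> x \<alpha> = {x}"
      unfolding thin_def by blast
    then show "\<exists>V. bounded_in \<B> V \<and> (\<forall>x\<in>support \<B> - V. card (f ` ball \<B> x \<alpha>) = 1)"
      by (intro exI[of _ V]) auto
  qed
  then show "\<forall>f\<in>support \<B> \<rightarrow> {0, 1}. slowly_oscillating \<B> f" by blast
next
  assume R: "\<forall>f\<in>support \<B> \<rightarrow> {0, 1}. slowly_oscillating \<B> f"
  show "thin \<B>"
  proof (rule ccontr)
    assume "\<not> thin \<B>"
    then obtain \<alpha> where \<alpha>: "\<alpha> \<in> radii \<B>" "\<not> bounded_in \<B> (moved \<B> \<alpha>)"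
      using thin_iff_moved_bounded by blast
    then obtain S where S: "S \<subseteq> support \<B>" "\<not> bounded_in \<B> S"
      "\<forall>x\<in>S. \<exists>y\<in>ball \<B> x \<alpha>. y \<notin> S"
      by (rule moved_unboundedE)
    define f :: "'a \<Rightarrow> nat" where "f x = (if x \<in> S then 1 else 0)" for x
    have "f \<in> support \<B> \<rightarrow> {0, 1}" by (simp add: f_def)
    with R \<alpha>(1) obtain V where V: "bounded_in \<B> V"
      "\<forall>x\<in>support \<B> - V. card (f ` ball \<B> x \<alpha>) = 1"
      unfolding slowly_oscillating_def by blast
    \<comment> \<open>Unboundedness of \<open>S\<close> leaves a point \<open>x\<close> of
      \<open>S\<close> outside \<open>V\<close>; its \<alpha>-ball also meets the complement of
      \<open>S\<close>, so \<open>f\<close> takes both values there.\<close>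
    have "\<not> S \<subseteq> V" using V(1) S(2) bounded_in_subset by blast
    then obtain x where x: "x \<in> S" "x \<notin> V" by blast
    then obtain y where y: "y \<in> ball \<B> x \<alpha>" "y \<notin> S" using S(3) by blast
    have "card (f ` ball \<B> x \<alpha>) = 1" using V(2) x S(1) by blast
    then obtain c where "f ` ball \<B> x \<alpha> = {c}" by (auto simp: card_1_singleton_iff)
    moreover have "x \<in> ball \<B> x \<alpha>" using x S(1) \<alpha>(1) ball_refl by blast
    ultimately have "f x = f y" using y(1) by (metis imageI singletonD)
    with x(1) y(2) show False by (simp add: f_def)
  qed
qed

section \<open>Complements of points in the hyperballean\<close>

lemma compl_singleton_in_exp_ball_iff:
  assumes \<alpha>: "\<alpha> \<in> radii \<B>" and xy: "x \<in> support \<B>" "y \<in> support \<B>" "x \<noteq> y"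
  shows "support \<B> - {y} \<in> ball (exp_ballean \<B>) (support \<B> - {x}) \<alpha> \<longleftrightarrow>
    x \<in> moved \<B> \<alpha> \<and> y \<in> moved \<B> \<alpha>"
proof -
  \<comment> \<open>The only point of the left side that does not cover itself is \<open>v\<close>,
    which belongs to it because \<open>u\<close> differs from \<open>v\<close>. It must be reached
    from another point, which is possible exactly when \<open>v\<close> is moved.\<close>
  have cover: "support \<B> - {u} \<subseteq> ball_of_set \<B> (support \<B> - {v}) \<alpha> \<longleftrightarrow> v \<in> moved \<B> \<alpha>"
    if uv: "u \<in> support \<B>" "v \<in> support \<B>" "u \<noteq> v" for u v
  proof
    assume "support \<B> - {u} \<subseteq> ball_of_set \<B> (support \<B> - {v}) \<alpha>"
    with uv obtain z where "z \<in> support \<B>" "z \<noteq> v" "v \<in> ball \<B> z \<alpha>"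
      unfolding ball_of_set_def by blast
    then show "v \<in> moved \<B> \<alpha>" using moved_memI ball_sym \<alpha> uv by blast
  next
    assume v: "v \<in> moved \<B> \<alpha>"
    show "support \<B> - {u} \<subseteq> ball_of_set \<B> (support \<B> - {v}) \<alpha>"
    proof
      fix w assume "w \<in> support \<B> - {u}"
      then show "w \<in> ball_of_set \<B> (support \<B> - {v}) \<alpha>"
        using moved_memE[OF \<alpha> v] ball_refl \<alpha> unfolding ball_of_set_def by (cases "w = v") blast+
    qed
  qed
  show ?thesis using cover xy by (auto simp: exp_ballean_def)
qed

text \<open>\<open>C\<close> is injective and always coarse, since two distinct points in a common
  \<alpha>-ball relation are both moved. The content of the equivalence is thus the coarseness of
  the inverse.\<close>

lemma thin_iff_asymorphism_compl_singleton:
  defines "C \<equiv> \<lambda>x. support \<B> - {x}"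
  shows "thin \<B> \<longleftrightarrow> asymorphism \<B> (subballean (exp_ballean \<B>) (C ` support \<B>)) C"
proof -
  let ?E = "subballean (exp_ballean \<B>) (C ` support \<B>)"
  have inj: "inj_on C (support \<B>)" by (auto simp: inj_on_def C_def)
  then have bij: "bij_betw C (support \<B>) (support ?E)"
    by (simp add: subballean_def bij_betw_def)
  have radii_E: "radii ?E = radii \<B>" by (simp add: subballean_def exp_ballean_def)
  have support_E: "support ?E = C ` support \<B>" by (simp add: subballean_def)
  have ball_E: "C y \<in> ball ?E (C x) \<alpha> \<longleftrightarrow> x = y \<or> x \<in> moved \<B> \<alpha> \<and> y \<in> moved \<B> \<alpha>"
    if "\<alpha> \<in> radii \<B>" "x \<in> support \<B>" "y \<in> support \<B>" for x y \<alpha>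
  proof (cases "x = y")
    case True
    interpret E: ballean "exp_ballean \<B>" by (rule ballean_exp)
    have "C y \<in> ball (exp_ballean \<B>) (C y) \<alpha>"
      using E.ball_refl that by (simp add: exp_ballean_def C_def)
    with True that show ?thesis by (simp add: subballean_def)
  next
    case False
    then show ?thesis
      using compl_singleton_in_exp_ball_iff[OF that] that by (simp add: subballean_def C_def)
  qed
  have coarse: "coarse_map \<B> ?E C"
    unfolding coarse_map_def radii_E support_E
  proof (intro conjI ballI)
    fix \<alpha> assume \<alpha>: "\<alpha> \<in> radii \<B>"
    have "C y \<in> ball ?E (C x) \<alpha>" if "x \<in> support \<B>" "y \<in> ball \<B> x \<alpha>" for x y
      using ball_E[OF \<alpha> that(1), of y] moved_memI[OF \<alpha>] ball_sym[OF that(1), of y \<alpha>]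
        ball_subset[OF that(1) \<alpha>] \<alpha> that by blast
    with \<alpha> show "\<exists>\<beta>\<in>radii \<B>. \<forall>x\<in>support \<B>. C ` ball \<B> x \<alpha> \<subseteq> ball ?E (C x) \<beta>" by blast
  qed blast
  have inv: "inv_into (support \<B>) C (C x) = x" if "x \<in> support \<B>" for x
    using inj that by simp
  \<comment> \<open>Injectivity of \<open>C\<close> translates coarseness of the inverse into a
    condition on pairs of points of the support.\<close>
  have coarse_inv: "coarse_map ?E \<B> (inv_into (support \<B>) C) \<longleftrightarrow>
    (\<forall>\<alpha>\<in>radii \<B>. \<exists>\<beta>\<in>radii \<B>. \<forall>x\<in>support \<B>. \<forall>y\<in>support \<B>.
      C y \<in> ball ?E (C x) \<alpha> \<longrightarrow> y \<in> ball \<B> x \<beta>)"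
  proof -
    have "inv_into (support \<B>) C ` ball ?E (C x) \<alpha> \<subseteq> ball \<B> x \<beta> \<longleftrightarrow>
      (\<forall>y\<in>support \<B>. C y \<in> ball ?E (C x) \<alpha> \<longrightarrow> y \<in> ball \<B> x \<beta>)" for x \<alpha> \<beta>
    proof -
      have "ball ?E (C x) \<alpha> \<subseteq> C ` support \<B>" by (simp add: subballean_def)
      then show ?thesis by (force simp: inv)
    qed
    moreover have "inv_into (support \<B>) C \<in> C ` support \<B> \<rightarrow> support \<B>"
      by (auto simp: inv)
    ultimately show ?thesis
      unfolding coarse_map_def radii_E support_E by (simp add: inv)
  qed
  have "thin \<B> \<longleftrightarrow> coarse_map ?E \<B> (inv_into (support \<B>) C)"
    unfolding coarse_inv thin_iff_moved_bounded
  proof (intro ball_cong refl)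
    fix \<alpha> assume \<alpha>: "\<alpha> \<in> radii \<B>"
    have sup: "moved \<B> \<alpha> \<subseteq> support \<B>" by (auto simp: moved_def)
    \<comment> \<open>By \<open>ball_E\<close> the right side asks, up to the diagonal case settled
      by reflexivity, that any two moved points lie in each other's \<beta>-balls, which is
      boundedness of the moved set.\<close>
    show "bounded_in \<B> (moved \<B> \<alpha>) \<longleftrightarrow> (\<exists>\<beta>\<in>radii \<B>. \<forall>x\<in>support \<B>. \<forall>y\<in>support \<B>.
      C y \<in> ball ?E (C x) \<alpha> \<longrightarrow> y \<in> ball \<B> x \<beta>)"
      using sup ball_refl by (simp add: bounded_in_def ball_E[OF \<alpha>] subset_iff) blast
  qed
  with bij coarse show ?thesis unfolding asymorphism_def by blast
qed

section \<open>Connectedness of the non-thick hyperballean\<close>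

lemma thin_iff_connected_nonthick_hyperballean:
  assumes conn: "connected_ballean \<B>" and unb: "\<not> bounded_ballean \<B>"
  shows "thin \<B> \<longleftrightarrow> connected_ballean (nonthick_hyperballean \<B>)"
proof -
  let ?M = "{A. A \<subseteq> support \<B> \<and> A \<noteq> {} \<and> \<not> thick_in \<B> A}"
  have conn_iff: "connected_ballean (nonthick_hyperballean \<B>) \<longleftrightarrow>
    (\<forall>A\<in>?M. \<forall>C\<in>?M. \<exists>\<alpha>\<in>radii \<B>. A \<subseteq> ball_of_set \<B> C \<alpha> \<and> C \<subseteq> ball_of_set \<B> A \<alpha>)"
    unfolding connected_ballean_def nonthick_hyperballean_def subballean_def exp_ballean_def
    by simp
  show ?thesis
    unfolding conn_iff
  proof (intro iffI ballI)
    fix A C assume thin: "thin \<B>" and "A \<in> ?M" "C \<in> ?M"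
    then have AC: "bounded_in \<B> A" "A \<noteq> {}" "bounded_in \<B> C" "C \<noteq> {}"
      using thin_iff_nonthick_bounded by auto
    \<comment> \<open>A radius bounding the union makes the ball around any single point of one set
      cover the other; both sets are non-empty.\<close>
    then have "bounded_in \<B> (A \<union> C)" using bounded_in_Un[OF conn] by blast
    then obtain \<alpha> where "\<alpha> \<in> radii \<B>" "\<forall>y\<in>A \<union> C. A \<union> C \<subseteq> ball \<B> y \<alpha>"
      unfolding bounded_in_def by blast
    with AC(2,4) show "\<exists>\<alpha>\<in>radii \<B>. A \<subseteq> ball_of_set \<B> C \<alpha> \<and> C \<subseteq> ball_of_set \<B> A \<alpha>"
      by (intro bexI[of _ \<alpha>]) (unfold ball_of_set_def, blast+)
  next
    assume R: "\<forall>A\<in>?M. \<forall>C\<in>?M. \<exists>\<alpha>\<in>radii \<B>.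
      A \<subseteq> ball_of_set \<B> C \<alpha> \<and> C \<subseteq> ball_of_set \<B> A \<alpha>"
    have "bounded_in \<B> A" if A: "A \<subseteq> support \<B>" "\<not> thick_in \<B> A" for A
    proof (cases "A = {}")
      \<comment> \<open>The empty set is excluded from \<open>?M\<close> and is bounded vacuously,
        with any radius.\<close>
      case True
      then show ?thesis using radii_nonempty by (auto simp: bounded_in_def)
    next
      case False
      then obtain x where x: "x \<in> support \<B>" using A by blast
      obtain \<delta> where "\<delta> \<in> radii \<B>" using radii_nonempty by blast
      \<comment> \<open>The goal is to show that \<open>{x}\<close> is not thick. Unboundedness
        gives a second point \<open>y\<close>, and connectedness a radius whose ball around
        \<open>x\<close> contains it.\<close>
      then have "\<not> support \<B> \<subseteq> ball \<B> x \<delta>"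
        using unb x bounded_in_ball bounded_in_subset unfolding bounded_ballean_def by blast
      then obtain y where y: "y \<in> support \<B>" "y \<noteq> x"
        using ball_refl[OF x \<open>\<delta> \<in> radii \<B>\<close>] by blast
      then obtain \<beta> where "\<beta> \<in> radii \<B>" "y \<in> ball \<B> x \<beta>"
        using conn x unfolding connected_ballean_def by blast
      with y have "\<not> thick_in \<B> {x}" unfolding thick_in_def by blast
      with x have "{x} \<in> ?M" by simp
      moreover have "A \<in> ?M" using A False by simp
      \<comment> \<open>Closeness to a singleton confines \<open>A\<close> to one ball around
        \<open>x\<close>.\<close>
      ultimately have "\<exists>\<alpha>\<in>radii \<B>. A \<subseteq> ball_of_set \<B> {x} \<alpha> \<and> {x} \<subseteq> ball_of_set \<B> A \<alpha>"
        using R by meson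
      then obtain \<alpha> where "\<alpha> \<in> radii \<B>" "A \<subseteq> ball_of_set \<B> {x} \<alpha>" by blast
      then show ?thesis
        using bounded_in_subset[OF bounded_in_ball[OF x]] by (simp add: ball_of_set_def)
    qed
    then show "thin \<B>" using thin_iff_nonthick_bounded by blast
  qed
qed

end

theorem theorem2p2:
  fixes \<B> :: "('a, 'p) ball_structure"
  assumes "ballean \<B>"
    and "connected_ballean \<B>"
    and "\<not> bounded_ballean \<B>"
  shows "(thin \<B> \<longleftrightarrow> coincide \<B> (satellite \<B>)) \<and>
    (thin \<B> \<longleftrightarrow> (\<forall>A. A \<subseteq> support \<B> \<and> \<not> thick_in \<B> A \<longrightarrow> bounded_in \<B> A)) \<and>
    (thin \<B> \<longleftrightarrow> connected_ballean (nonthick_hyperballean \<B>)) \<and>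
    (let C = (\<lambda>x. support \<B> - {x}) in
      thin \<B> \<longleftrightarrow> asymorphism \<B> (subballean (exp_ballean \<B>) (C ` support \<B>)) C) \<and>
    (thin \<B> \<longleftrightarrow> (\<forall>f\<in>support \<B> \<rightarrow> {0, 1}. slowly_oscillating \<B> f))"
proof -
  interpret ballean \<B> by (rule assms(1))
  show ?thesis
    unfolding Let_def
    using thin_iff_coincide_satellite thin_iff_nonthick_bounded
      thin_iff_connected_nonthick_hyperballean[OF assms(2,3)]
      thin_iff_asymorphism_compl_singleton thin_iff_slowly_oscillating
    by blast
qed

end
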